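(* Let $A$ be an abelian surface. The subsets $S_d(A)$ define an increasing filtration $S_\bullet(A)$ on $\mathrm{CH}_0(A)$, i.e. $S_d(A)\subset S_{d+1}(A)$ for all $d\ge 0$.
   Context: We work over $\mathbb{C}$. $A$ is an abelian surface with origin $o_A$, $\iota$ is the involution $a\mapsto -a$, $\mathrm{CH}_0(A)$ is the Chow group of $0$-cycles, $\equiv$ is rational equivalence, and sums of cycles are taken in $\mathrm{CH}_0(A)$. A cycle is symmetric if it is $\iota$-invariant. For an integer $d\ge0$, $$S_d(A):=\{z\in \mathrm{CH}_0(A): z+\iota(z)\equiv y+2m\,o_A,\ m\in\mathbb{Z},\ y \text{ an effective symmetric } 0\text{-cycle of degree } 2d\}.$$ *)

theory Defs
  imports
    "HOL-Analysis.Analysis"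
    "HOL-Algebra.Free_Abelian_Groups"
    "HOL-Algebra.Generated_Groups"
    "HOL-Algebra.QuotRing"
begin

subsection \<open>Polynomials and projective space\<close>

type_synonym 'v cpoly = "('v \<Rightarrow>\<^sub>0 nat) \<Rightarrow>\<^sub>0 complex"

definition peval :: "'v cpoly \<Rightarrow> ('v \<Rightarrow> complex) \<Rightarrow> complex" where
  "peval p x = (\<Sum>m\<in>Poly_Mapping.keys p. Poly_Mapping.lookup p m *
                 (\<Prod>i\<in>Poly_Mapping.keys m. x i ^ Poly_Mapping.lookup m i))"

definition homogeneous :: "nat \<Rightarrow> 'v::finite cpoly \<Rightarrow> bool" where
  "homogeneous d p \<longleftrightarrow>
     (\<forall>m\<in>Poly_Mapping.keys p. (\<Sum>i\<in>UNIV. Poly_Mapping.lookup m i) = d)"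

definition bihomogeneous :: "nat \<Rightarrow> nat \<Rightarrow> ('v::finite + 'w::finite) cpoly \<Rightarrow> bool" where
  "bihomogeneous d e p \<longleftrightarrow>
     (\<forall>m\<in>Poly_Mapping.keys p. (\<Sum>i\<in>UNIV. Poly_Mapping.lookup m (Inl i)) = d \<and>
                               (\<Sum>j\<in>UNIV. Poly_Mapping.lookup m (Inr j)) = e)"

text \<open>The points of \<open>'n proj_space\<close> are the lines through the origin of \<open>complex ^ 'n\<close>, so this is
  the complex projective space of dimension \<open>CARD('n) - 1\<close>.\<close>

typedef (overloaded) 'n::finite proj_space =
  "{L :: (complex ^ 'n) set. vec.subspace L \<and> vec.dim L = 1}"
proof -
  let ?v = "1 :: complex ^ 'n"
  have "vec.dim (vec.span {?v}) = card {?v}"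
    by (intro vec.dim_span_eq_card_independent) (simp add: vec.dependent_single)
  then show ?thesis
    by (intro exI[of _ "vec.span {?v}"]) (simp add: vec.subspace_span)
qed

definition hcoords :: "'n::finite proj_space \<Rightarrow> (complex ^ 'n) set" where
  "hcoords P = Rep_proj_space P - {0}"

definition nonvanishing :: "'n::finite cpoly \<Rightarrow> 'n proj_space \<Rightarrow> bool" where
  "nonvanishing p P \<longleftrightarrow> (\<forall>v\<in>hcoords P. peval p (($) v) \<noteq> 0)"

text \<open>For homogeneous \<open>p\<close> and \<open>q\<close> of the same degree the value of \<open>form_quot p q\<close> does not
  depend on the chosen homogeneous coordinates.\<close>

definition form_quot :: "'n::finite cpoly \<Rightarrow> 'n cpoly \<Rightarrow> 'n proj_space \<Rightarrow> complex" where
  "form_quot p q P =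
     (let v = SOME v. v \<in> hcoords P in peval p (($) v) / peval q (($) v))"

subsection \<open>Varieties, dimension and morphisms\<close>

definition zariski :: "'n::finite proj_space topology" where
  "zariski = topology_generated_by {{P. nonvanishing p P} | p d. homogeneous d p}"

text \<open>The Zariski topology of the product variety (via the Segre embedding), which is finer than
  the product of the two Zariski topologies.\<close>

definition zariski2 :: "('m::finite proj_space \<times> 'n::finite proj_space) topology" where
  "zariski2 = topology_generated_by
     {{(P, Q). \<forall>v\<in>hcoords P. \<forall>w\<in>hcoords Q. peval p (case_sum (($) v) (($) w)) \<noteq> 0}
        | p d e. bihomogeneous d e p}"

definition irreducible_closed :: "'a topology \<Rightarrow> 'a set \<Rightarrow> bool" where
  "irreducible_closed T Z \<longleftrightarrow> closedin T Z \<and> Z \<noteq> {} \<and>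
     (\<forall>C D. closedin T C \<and> closedin T D \<and> Z \<subseteq> C \<union> D \<longrightarrow> Z \<subseteq> C \<or> Z \<subseteq> D)"

definition irreducible_chain :: "'a topology \<Rightarrow> 'a set \<Rightarrow> nat \<Rightarrow> bool" where
  "irreducible_chain T X n \<longleftrightarrow>
     (\<exists>Z :: nat \<Rightarrow> 'a set. (\<forall>i\<le>n. irreducible_closed T (Z i) \<and> Z i \<subseteq> X) \<and>
                            (\<forall>i<n. Z i \<subset> Z (Suc i)))"

definition projective_variety :: "'n::finite proj_space set \<Rightarrow> nat \<Rightarrow> bool" where
  "projective_variety X d \<longleftrightarrow> irreducible_closed zariski X \<and>
     irreducible_chain zariski X d \<and> \<not> irreducible_chain zariski X (Suc d)"

definition morphism :: "'m::finite proj_space set \<Rightarrow> 'n::finite proj_space set \<Rightarrow>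
    ('m proj_space \<Rightarrow> 'n proj_space) \<Rightarrow> bool" where
  "morphism X Y f \<longleftrightarrow> f ` X \<subseteq> Y \<and>
     (\<forall>P\<in>X. \<exists>U d F. openin zariski U \<and> P \<in> U \<and> (\<forall>i. homogeneous d (F i)) \<and>
        (\<forall>Q\<in>X \<inter> U. \<forall>v\<in>hcoords Q. (\<chi> i. peval (F i) (($) v)) \<in> hcoords (f Q)))"

definition morphism2 :: "'l::finite proj_space set \<Rightarrow> 'm::finite proj_space set \<Rightarrow>
    'n::finite proj_space set \<Rightarrow> ('l proj_space \<Rightarrow> 'm proj_space \<Rightarrow> 'n proj_space) \<Rightarrow> bool" where
  "morphism2 X Y Z f \<longleftrightarrow> (\<forall>P\<in>X. \<forall>Q\<in>Y. f P Q \<in> Z) \<and>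
     (\<forall>P\<in>X. \<forall>Q\<in>Y. \<exists>U d e F. openin zariski2 U \<and> (P, Q) \<in> U \<and>
        (\<forall>i. bihomogeneous d e (F i)) \<and>
        (\<forall>(R, S)\<in>(X \<times> Y) \<inter> U. \<forall>v\<in>hcoords R. \<forall>w\<in>hcoords S.
           (\<chi> i. peval (F i) (case_sum (($) v) (($) w))) \<in> hcoords (f R S)))"

text \<open>An abelian surface is a projective group variety of dimension 2.  Smoothness and
  commutativity are consequences.  The group law is written multiplicatively: the origin is
  \<open>\<one>\<^bsub>A\<^esub>\<close> and the involution is \<open>m_inv A\<close>.\<close>

definition abelian_surface :: "'n::finite proj_space monoid \<Rightarrow> bool" where
  "abelian_surface A \<longleftrightarrow> group A \<and> projective_variety (carrier A) 2 \<and>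
     morphism2 (carrier A) (carrier A) (carrier A) (mult A) \<and>
     morphism (carrier A) (carrier A) (m_inv A)"

subsection \<open>Local rings and divisors of rational functions\<close>

definition regular_at ::
    "'n::finite proj_space set \<Rightarrow> 'n proj_space \<Rightarrow> ('n proj_space \<Rightarrow> complex) \<Rightarrow> bool" where
  "regular_at W P f \<longleftrightarrow>
     (\<exists>U d p q. openin zariski U \<and> P \<in> U \<and> homogeneous d p \<and> homogeneous d q \<and>
        (\<forall>Q\<in>W \<inter> U. nonvanishing q Q \<and> f Q = form_quot p q Q))"

definition regular_ring ::
    "'n::finite proj_space set \<Rightarrow> 'n proj_space \<Rightarrow> ('n proj_space \<Rightarrow> complex) ring" where
  "regular_ring W P =
     \<lparr>carrier = {f. regular_at W P f},
      mult = (\<lambda>f g Q. f Q * g Q), one = (\<lambda>Q. 1),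
      zero = (\<lambda>Q. 0), add = (\<lambda>f g Q. f Q + g Q)\<rparr>"

definition germ_zero ::
    "'n::finite proj_space set \<Rightarrow> 'n proj_space \<Rightarrow> ('n proj_space \<Rightarrow> complex) set" where
  "germ_zero W P = {f. \<exists>U. openin zariski U \<and> P \<in> U \<and> (\<forall>Q\<in>W \<inter> U. f Q = 0)}"

text \<open>The local ring of \<open>W\<close> at \<open>P\<close> is the stalk of the sheaf of regular functions.  Functions are
  total, but only their values on \<open>W\<close> near \<open>P\<close> matter, so that two of them have the same germ iff
  their difference lies in \<open>germ_zero W P\<close>.\<close>

definition local_ring ::
    "'n::finite proj_space set \<Rightarrow> 'n proj_space \<Rightarrow> ('n proj_space \<Rightarrow> complex) set ring" where
  "local_ring W P = regular_ring W P Quot germ_zero W P"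

definition germ :: "'n::finite proj_space set \<Rightarrow> 'n proj_space \<Rightarrow> ('n proj_space \<Rightarrow> complex) \<Rightarrow>
    ('n proj_space \<Rightarrow> complex) set" where
  "germ W P f = germ_zero W P +>\<^bsub>regular_ring W P\<^esub> f"

text \<open>The length of a commutative ring as a module over itself.  Only used for rings of finite
  length.\<close>

definition ring_length :: "('a, 'b) ring_scheme \<Rightarrow> nat" where
  "ring_length R = (GREATEST n. \<exists>I :: nat \<Rightarrow> 'a set.
     (\<forall>i\<le>n. ideal (I i) R) \<and> (\<forall>i<n. I i \<subset> I (Suc i)))"

definition ord_germ :: "'n::finite proj_space set \<Rightarrow> 'n proj_space \<Rightarrow>
    ('n proj_space \<Rightarrow> complex) \<Rightarrow> nat" where
  "ord_germ W P f = ring_length (local_ring W P Quot (PIdl\<^bsub>local_ring W P\<^esub> (germ W P f)))"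

text \<open>\<open>D\<close> is the divisor of the nonzero rational function \<open>p / q\<close> on the curve \<open>W\<close>.  Writing
  \<open>p / q = (p / h) / (q / h)\<close>, where the form \<open>h\<close> does not vanish at \<open>P\<close>, presents it as a quotient
  of two elements of the local ring at \<open>P\<close>, and its order at \<open>P\<close> is the difference of the lengths of
  the local ring modulo \<open>p / h\<close> and modulo \<open>q / h\<close>.  The choice of \<open>h\<close> does not matter.  No
  smoothness of \<open>W\<close> is needed.\<close>

definition principal_divisor ::
    "'n::finite proj_space set \<Rightarrow> ('n proj_space \<Rightarrow>\<^sub>0 int) \<Rightarrow> bool" where
  "principal_divisor W D \<longleftrightarrow>
     (\<exists>d p q. homogeneous d p \<and> homogeneous d q \<and>
        (\<exists>P\<in>W. nonvanishing p P) \<and> (\<exists>P\<in>W. nonvanishing q P) \<and>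
        Poly_Mapping.keys D \<subseteq> W \<and>
        (\<forall>P\<in>W. \<exists>h. homogeneous d h \<and> nonvanishing h P \<and>
           Poly_Mapping.lookup D P =
             int (ord_germ W P (form_quot p h)) - int (ord_germ W P (form_quot q h))))"

subsection \<open>Zero-cycles and the Chow group\<close>

abbreviation zero_cycles :: "'n::finite proj_space set \<Rightarrow> ('n proj_space \<Rightarrow>\<^sub>0 int) monoid" where
  "zero_cycles X \<equiv> free_Abelian_group X"

definition rationally_trivial ::
    "'n::finite proj_space set \<Rightarrow> ('n proj_space \<Rightarrow>\<^sub>0 int) set" where
  "rationally_trivial X = generate (zero_cycles X)
     {D. \<exists>W. W \<subseteq> X \<and> projective_variety W 1 \<and> principal_divisor W D}"

definition CH0 :: "'n::finite proj_space set \<Rightarrow> ('n proj_space \<Rightarrow>\<^sub>0 int) set monoid" where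
  "CH0 X = zero_cycles X Mod rationally_trivial X"

definition cycle_class :: "'n::finite proj_space set \<Rightarrow> ('n proj_space \<Rightarrow>\<^sub>0 int) \<Rightarrow>
    ('n proj_space \<Rightarrow>\<^sub>0 int) set" where
  "cycle_class X z = rationally_trivial X #>\<^bsub>zero_cycles X\<^esub> z"

definition cycle_degree :: "('a \<Rightarrow>\<^sub>0 int) \<Rightarrow> int" where
  "cycle_degree z = (\<Sum>P\<in>Poly_Mapping.keys z. Poly_Mapping.lookup z P)"

definition effective :: "('a \<Rightarrow>\<^sub>0 int) \<Rightarrow> bool" where
  "effective z \<longleftrightarrow> (\<forall>P. 0 \<le> Poly_Mapping.lookup z P)"

definition cycle_inv :: "('a, 'b) monoid_scheme \<Rightarrow> ('a \<Rightarrow>\<^sub>0 int) \<Rightarrow> ('a \<Rightarrow>\<^sub>0 int)" where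
  "cycle_inv A = frag_extend (\<lambda>P. frag_of (inv\<^bsub>A\<^esub> P))"

definition symmetric :: "('a, 'b) monoid_scheme \<Rightarrow> ('a \<Rightarrow>\<^sub>0 int) \<Rightarrow> bool" where
  "symmetric A z \<longleftrightarrow> cycle_inv A z = z"

text \<open>Elements of the Chow group are cosets of cycles.  The involution is an automorphism of the
  variety and hence preserves rational triviality, so it acts on the Chow group by taking images of
  cosets.\<close>

definition S_filt :: "'n::finite proj_space monoid \<Rightarrow> nat \<Rightarrow> ('n proj_space \<Rightarrow>\<^sub>0 int) set set" where
  "S_filt A d = {z \<in> carrier (CH0 (carrier A)).
     \<exists>y m. y \<in> carrier (zero_cycles (carrier A)) \<and> effective y \<and> symmetric A y \<and>
       cycle_degree y = 2 * int d \<and>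
       z \<otimes>\<^bsub>CH0 (carrier A)\<^esub> (cycle_inv A ` z) =
         cycle_class (carrier A) (y + frag_cmul (2 * m) (frag_of \<one>\<^bsub>A\<^esub>))}"

end

theory Submission
  imports Defs
begin

text \<open>The origin is a fixed point of the involution, so \<open>2 o\<close> is itself an effective symmetric
  cycle of degree 2.  If \<open>y + 2m o\<close> witnesses membership of a class in the \<open>d\<close>-th step of the
  filtration, then moving one copy of \<open>2 o\<close> from the second summand to the first,
  \<open>y + 2m o = (y + 2 o) + 2(m - 1) o\<close>, leaves the cycle unchanged and raises the degree of its
  effective symmetric part by 2, which is what the next step asks for.  This is an equality of
  cycles, hence one of their classes.\<close>

lemma cycle_degree_add: "cycle_degree (y + z) = cycle_degree y + cycle_degree z"
proof -
  \<comment> \<open>Cancellation can make the support of a sum smaller than the union of the two supports, so all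
    three degrees are computed over that union.\<close>
  let ?K = "Poly_Mapping.keys y \<union> Poly_Mapping.keys z"
  have degree: "cycle_degree w = (\<Sum>P\<in>?K. Poly_Mapping.lookup w P)"
    if "Poly_Mapping.keys w \<subseteq> ?K" for w
    unfolding cycle_degree_def using that
    by (intro sum.mono_neutral_left) (auto simp: in_keys_iff)
  show ?thesis
    using degree[of y] degree[of z] degree[OF Poly_Mapping.keys_add]
    by (simp add: lookup_add sum.distrib)
qed

lemma cycle_degree_frag_of: "cycle_degree (frag_of P) = 1"
  by (simp add: cycle_degree_def)

lemma effective_add: "effective y \<Longrightarrow> effective z \<Longrightarrow> effective (y + z)"
  by (simp add: effective_def lookup_add)

lemma effective_frag_of: "effective (frag_of P)"
  by (simp add: effective_def lookup_single when_def)

lemma symmetric_add: "symmetric A y \<Longrightarrow> symmetric A z \<Longrightarrow> symmetric A (y + z)"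
  by (simp add: symmetric_def cycle_inv_def frag_extend_add)

lemma (in group) symmetric_frag_of_one: "symmetric G (frag_of \<one>)"
  by (simp add: symmetric_def cycle_inv_def)

theorem lemma3p3:
  fixes A :: "'n::finite proj_space monoid"
  assumes "abelian_surface A"
  shows "\<forall>d. S_filt A d \<subseteq> S_filt A (Suc d)"
proof (intro allI subsetI)
  fix d z
  assume z: "z \<in> S_filt A d"
  interpret group A
    using assms by (simp add: abelian_surface_def)
  let ?o = "frag_of \<one>\<^bsub>A\<^esub>"
  from z obtain y m where y: "y \<in> carrier (zero_cycles (carrier A))" "effective y"
      "symmetric A y" "cycle_degree y = 2 * int d"
    and eq: "z \<otimes>\<^bsub>CH0 (carrier A)\<^esub> (cycle_inv A ` z) =
      cycle_class (carrier A) (y + frag_cmul (2 * m) ?o)"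
    and carrier: "z \<in> carrier (CH0 (carrier A))"
    by (auto simp: S_filt_def)
  let ?y = "y + (?o + ?o)"
  have "?y \<in> carrier (zero_cycles (carrier A))"
  proof -
    have "Poly_Mapping.keys ?y \<subseteq> Poly_Mapping.keys y \<union> {\<one>\<^bsub>A\<^esub>}"
      using Poly_Mapping.keys_add[of y "?o + ?o"] Poly_Mapping.keys_add[of ?o ?o] by auto
    then show ?thesis
      using y(1) by auto
  qed
  moreover have "effective ?y"
    by (intro effective_add effective_frag_of y)
  moreover have "symmetric A ?y"
    by (intro symmetric_add symmetric_frag_of_one y)
  moreover have "cycle_degree ?y = 2 * int (Suc d)"
    using y(4) by (simp add: cycle_degree_add cycle_degree_frag_of)
  moreover have "y + frag_cmul (2 * m) ?o = ?y + frag_cmul (2 * (m - 1)) ?o"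
    by (rule poly_mapping_eqI) (simp add: lookup_add algebra_simps)
  ultimately show "z \<in> S_filt A (Suc d)"
    using eq carrier unfolding S_filt_def mem_Collect_eq by metis
qed

end
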